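(* Let $d^{\rm RP}_{(n_0,\ldots,n_N)}(k)$ denote the DMT, at integer multiplexing gain $k$, of the $(n_0,\ldots,n_N)$ Rayleigh product channel, given by the closed form recalled in the context. It can be alternatively characterized by the following relations, which hold for every $N$ and every dimension: $$\mathrm{(R_1)}\quad d^{\rm RP}_{(n_0,\ldots,n_N)}(k)=d^{\rm RP}_{(n_0-k,\ldots,n_N-k)}(0)\quad\text{for all }k;$$ $$\mathrm{(R_2)}\quad d^{\rm RP}_{(n_0,\ldots,n_N)}(0)=\min_{j\ge0}\Big\{d^{\rm RP}_{(n_0,\ldots,n_i)}(j)+d^{\rm RP}_{(j,n_{i+1},\ldots,n_N)}(0)\Big\}\quad\text{for all }i;$$ $$\mathrm{(R_3)}\quad d^{\rm RP}_{(n_0,\ldots,n_N)}(k)=\min_{j\ge k}\Big\{d^{\rm RP}_{(n_0,\ldots,n_i)}(j)+d^{\rm RP}_{(j,n_{i+1},\ldots,n_N)}(k)\Big\}\quad\text{for all }i,k.$$ Here $k$ ranges over the integers $0\le k\le \min_{0\le l\le N} n_l$, $i$ ranges over $1\le i\le N-1$, and $j$ over integers in $[0,\min_{0\le l\le i}n_l]$ (resp. $[k,\min_{0\le l\le i}n_l]$).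
   Context: For $N\ge1$ and nonnegative integers $n_0,\ldots,n_N$ with increasingly ordered version $\tilde n_0\le\cdots\le\tilde n_N$ and $n_{\min}=\tilde n_0$, the closed form is $$d^{\rm RP}_{(n_0,\ldots,n_N)}(k)=\sum_{i=k+1}^{n_{\min}}c_i,\qquad c_i=1-i+\min_{m=1,\ldots,N}\left\lfloor\frac{\sum_{l=0}^m\tilde n_l-i}{m}\right\rfloor,\qquad k=0,1,\ldots,n_{\min}.$$ An empty sum is $0$, so $d^{\rm RP}=0$ whenever $k=n_{\min}$, in particular if some dimension is $0$. (This is the value at integer $k$ of the DMT of the $(n_0,\ldots,n_N)$ Rayleigh product channel, the MIMO channel with matrix $\mathbf H_1\cdots\mathbf H_N$, where $\mathbf H_i\in\mathbb C^{n_{i-1}\times n_i}$ are independent with i.i.d. $\mathcal{CN}(0,1)$ entries.)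
   Formalization: The relations alone do not determine the DMT (the zero family satisfies all three), so "characterized" is stated as: the relations hold, and any integer-valued family satisfying them whose values for N=1, i.e. on (n_0,n_1), agree with the closed form equals it everywhere. *)

theory Defs
  imports Main
begin

text \<open>
  The dimensions \<open>(n\<^sub>0, \<dots>, n\<^sub>N)\<close> form a list \<open>ns\<close> of natural numbers with
  \<open>ns ! l = n\<^sub>l\<close>, so \<open>N = length ns - 1\<close>, and \<open>N \<ge> 1\<close> means \<open>2 \<le> length ns\<close>.
  The sorted list \<open>sort ns\<close> contains the increasingly ordered dimensions.
\<close>

definition nmin :: "nat list \<Rightarrow> nat" where
  "nmin ns = Min (set ns)"

text \<open>
  The coefficients \<open>c\<^sub>i\<close> are integers; \<open>div\<close> on \<open>int\<close> is the floor of the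
  rational quotient.
\<close>

definition rp_coeff :: "nat list \<Rightarrow> nat \<Rightarrow> int" where
  "rp_coeff ns i =
     1 - int i
     + (MIN m\<in>{1..length ns - 1}. (int (\<Sum>l=0..m. sort ns ! l) - int i) div int m)"

definition dRP :: "nat list \<Rightarrow> nat \<Rightarrow> int" where
  "dRP ns k = (\<Sum>i=k+1..nmin ns. rp_coeff ns i)"

text \<open>
  The relations, for a family \<open>d\<close> of functions indexed by the dimensions.
  \<open>take (Suc i) ns\<close> is \<open>(n\<^sub>0, \<dots>, n\<^sub>i)\<close> and \<open>j # drop (Suc i) ns\<close> is
  \<open>(j, n\<^bsub>i+1\<^esub>, \<dots>, n\<^sub>N)\<close>. As \<open>k \<le> nmin ns\<close>, the subtractions \<open>n - k\<close>
  are not truncated.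
\<close>

definition rel_R1 :: "(nat list \<Rightarrow> nat \<Rightarrow> int) \<Rightarrow> bool" where
  "rel_R1 d \<longleftrightarrow>
     (\<forall>ns k. 2 \<le> length ns \<longrightarrow> k \<le> nmin ns \<longrightarrow>
        d ns k = d (map (\<lambda>n. n - k) ns) 0)"

definition rel_R2 :: "(nat list \<Rightarrow> nat \<Rightarrow> int) \<Rightarrow> bool" where
  "rel_R2 d \<longleftrightarrow>
     (\<forall>ns i. 2 \<le> length ns \<longrightarrow> 1 \<le> i \<longrightarrow> i + 1 \<le> length ns - 1 \<longrightarrow>
        d ns 0 = (MIN j\<in>{0..nmin (take (Suc i) ns)}.
                    d (take (Suc i) ns) j + d (j # drop (Suc i) ns) 0))"

definition rel_R3 :: "(nat list \<Rightarrow> nat \<Rightarrow> int) \<Rightarrow> bool" where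
  "rel_R3 d \<longleftrightarrow>
     (\<forall>ns i k. 2 \<le> length ns \<longrightarrow> 1 \<le> i \<longrightarrow> i + 1 \<le> length ns - 1 \<longrightarrow> k \<le> nmin ns \<longrightarrow>
        d ns k = (MIN j\<in>{k..nmin (take (Suc i) ns)}.
                    d (take (Suc i) ns) j + d (j # drop (Suc i) ns) k))"

end

theory Submission
  imports Defs "HOL-Library.Multiset"
begin

text \<open>
  Put \<open>f(v) = v - \<Sum>\<^sub>l (v - n\<^sub>l)\<^sup>+\<close>. This function increases with slope 1 up to \<open>n\<^sub>m\<^sub>i\<^sub>n\<close>
  and is nonincreasing afterwards, and \<open>c\<^sub>i\<close> counts the integers \<open>v\<close> with \<open>f(v) \<ge> i\<close>. Hence
  the closed form equals \<open>\<Sum>\<^sub>v (f(v) - k)\<^sup>+\<close>, from which \<open>R\<^sub>1\<close> follows by shifting \<open>v\<close>.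
  In this form \<open>R\<^sub>3\<close> can be proved for each \<open>v\<close> separately: with \<open>A\<close> and \<open>B\<close> the two parts of
  \<open>\<Sum>\<^sub>l (v - n\<^sub>l)\<^sup>+\<close>, the inequality is \<open>(x + y)\<^sup>+ \<le> x\<^sup>+ + y\<^sup>+\<close> for \<open>x = v - A - j\<close> and
  \<open>y = j - B - k\<close>. The minimum is attained at the least \<open>j\<close> such that no \<open>v\<close> has \<open>x > 0 > y\<close>;
  by the shape of \<open>v - A\<close> and the monotonicity of \<open>B\<close>, no \<open>v\<close> has \<open>x < 0 < y\<close> either.
\<close>

section \<open>The closed form as a sum of positive parts\<close>

text \<open>Subtraction on \<open>nat\<close> truncates at 0, so \<open>v - excess ns v\<close> is
  the positive part of f(v).\<close>

definition excess :: "nat list \<Rightarrow> nat \<Rightarrow> nat" where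
  "excess ns v = (\<Sum>n\<leftarrow>ns. v - n)"

lemma excess_Cons [simp]: "excess (n # ns) v = (v - n) + excess ns v"
  by (simp add: excess_def)

lemma excess_append: "excess (xs @ ys) v = excess xs v + excess ys v"
  by (simp add: excess_def)

lemma excess_sort: "excess (sort ns) v = excess ns v"
proof -
  have "mset (map (\<lambda>n. v - n) (sort ns)) = mset (map (\<lambda>n. v - n) ns)"
    by simp
  then show ?thesis
    unfolding excess_def by (metis sum_mset_sum_list)
qed

lemma excess_mono: "v \<le> w \<Longrightarrow> excess ns v \<le> excess ns w"
  unfolding excess_def by (intro sum_list_mono) simp

lemma nmin_le: "n \<in> set ns \<Longrightarrow> nmin ns \<le> n"
  by (simp add: nmin_def)

lemma nmin_in: "ns \<noteq> [] \<Longrightarrow> nmin ns \<in> set ns"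
  by (simp add: nmin_def)

lemma excess_eq_0: "v \<le> nmin ns \<Longrightarrow> excess ns v = 0"
  using nmin_le[of _ ns] by (auto simp: excess_def) (meson le_trans)

text \<open>From \<open>nmin ns\<close> on, the term split off cancels the growth of
  \<open>v\<close> and leaves f(v) = \<open>nmin ns\<close> minus the monotone
  \<open>excess ms v\<close>.\<close>

lemma excess_split_nmin:
  assumes "ns \<noteq> []"
  obtains ms where "\<And>v. excess ns v = (v - nmin ns) + excess ms v"
proof -
  obtain xs ys where "ns = xs @ nmin ns # ys"
    using nmin_in[OF assms] by (meson split_list)
  then have "excess ns v = (v - nmin ns) + excess (xs @ ys) v" for v
    by (metis excess_append excess_Cons add.left_commute)
  then show thesis by (rule that)
qed

lemma minus_excess_le_nmin:
  assumes "ns \<noteq> []"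
  shows "v - excess ns v \<le> nmin ns"
proof -
  obtain ms where "\<And>v. excess ns v = (v - nmin ns) + excess ms v"
    using excess_split_nmin[OF assms] by blast
  then show ?thesis by simp
qed

lemma minus_excess_antimono:
  assumes "ns \<noteq> []" "nmin ns \<le> v" "v \<le> w"
  shows "w - excess ns w \<le> v - excess ns v"
proof -
  obtain ms where ms: "\<And>v. excess ns v = (v - nmin ns) + excess ms v"
    using excess_split_nmin[OF assms(1)] by blast
  show ?thesis
    using ms[of v] ms[of w] excess_mono[OF assms(3), of ms] assms by linarith
qed

text \<open>Two entries \<open>a\<close>, \<open>b\<close> already force f(v) \<le> a + b - v, so
  the sum over \<open>v\<close> is finite. With a single entry, f would stay constant past
  it.\<close>

lemma minus_excess_pos_le:
  assumes "2 \<le> length ns" "excess ns v < v"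
  shows "v \<le> sum_list ns"
proof -
  obtain a b xs where "ns = a # b # xs"
    using assms(1) by (metis Suc_le_length_iff numeral_2_eq_2)
  then show ?thesis using assms(2) by auto
qed

text \<open>In sorted order the entries below \<open>v\<close> come first, and \<open>p\<close> is
  their number. Together with \<open>prefix_le_excess\<close> this makes \<open>excess\<close> the
  maximum of the prefix sums.\<close>

lemma sorted_excess_prefix:
  assumes "sorted xs"
  shows "\<exists>p\<le>length xs. int (excess xs v) = (\<Sum>l<p. int v - int (xs ! l))"
  using assms
proof (induction xs)
  case Nil
  then show ?case by (simp add: excess_def)
next
  case (Cons x xs)
  show ?case
  proof (cases "x < v")
    case True
    from Cons obtain p where p: "p \<le> length xs"
      "int (excess xs v) = (\<Sum>l<p. int v - int (xs ! l))"
      by auto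
    have "int (excess (x # xs) v) = (\<Sum>l<Suc p. int v - int ((x # xs) ! l))"
      using True p(2) by (simp add: sum.lessThan_Suc_shift of_nat_diff del: sum.lessThan_Suc)
    then show ?thesis using p(1) by (metis Suc_le_mono length_Cons)
  next
    case False
    then have "excess (x # xs) v = 0"
      using Cons.prems by (fastforce simp: excess_def)
    then show ?thesis by (intro exI[of _ 0]) simp
  qed
qed

lemma prefix_le_excess:
  assumes "p \<le> length xs"
  shows "(\<Sum>l<p. int v - int (xs ! l)) \<le> int (excess xs v)"
proof -
  have "(\<Sum>l<p. int v - int (xs ! l)) \<le> (\<Sum>l<p. int (v - xs ! l))"
    by (intro sum_mono) simp
  also have "\<dots> \<le> (\<Sum>l<length xs. int (v - xs ! l))"
    using assms by (intro sum_mono2) auto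
  also have "\<dots> = int (excess xs v)"
    by (simp add: excess_def sum_list_sum_nth lessThan_atLeast0)
  finally show ?thesis .
qed

section \<open>Counting the integers v with f(v) \<ge> i\<close>

lemma int_le_div_iff:
  fixes a m v :: int
  assumes "0 < m"
  shows "v \<le> a div m \<longleftrightarrow> m * v \<le> a"
proof
  assume "v \<le> a div m"
  then have "m * v \<le> m * (a div m)" using assms by simp
  also have "\<dots> \<le> a"
    using mult_div_mod_eq[of m a] pos_mod_sign[OF assms, of a] by linarith
  finally show "m * v \<le> a" .
next
  assume "m * v \<le> a"
  then have "m * v div m \<le> a div m" using assms by (rule zdiv_mono1)
  then show "v \<le> a div m" using assms by simp
qed

text \<open>By the maximum over prefixes, i \<le> f(v) is one inequality per prefix length. Length 0
  gives \<open>i \<le> v\<close>, length 1 gives i \<le> \<open>nmin ns\<close>, and length m + 1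
  rearranges to the floor bound for \<open>m\<close>.\<close>

lemma le_rp_min_iff:
  assumes len: "2 \<le> length ns" and i: "i \<le> nmin ns"
  shows "i + excess ns v \<le> v \<longleftrightarrow>
    i \<le> v \<and> int v \<le> (MIN m\<in>{1..length ns - 1}. (int (\<Sum>l=0..m. sort ns ! l) - int i) div int m)"
    (is "?L \<longleftrightarrow> i \<le> v \<and> int v \<le> ?q")
proof -
  let ?s = "sort ns"
  have pref: "(\<Sum>l<Suc m. int v - int (?s ! l)) = (1 + int m) * int v - int (\<Sum>l=0..m. ?s ! l)" for m
    by (simp add: sum_subtractf atLeast0AtMost lessThan_Suc_atMost del: sum.lessThan_Suc)
  have q: "int v \<le> ?q \<longleftrightarrow> (\<forall>m\<in>{1..length ns - 1}. int m * int v \<le> int (\<Sum>l=0..m. ?s ! l) - int i)"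
  proof -
    have "int v \<le> ?q \<longleftrightarrow> (\<forall>m\<in>{1..length ns - 1}. int v \<le> (int (\<Sum>l=0..m. ?s ! l) - int i) div int m)"
      using len by (subst Min_ge_iff) auto
    also have "\<dots> \<longleftrightarrow> (\<forall>m\<in>{1..length ns - 1}. int m * int v \<le> int (\<Sum>l=0..m. ?s ! l) - int i)"
      by (intro ball_cong refl int_le_div_iff) auto
    finally show ?thesis .
  qed
  show ?thesis
  proof
    assume L: ?L
    have "int m * int v \<le> int (\<Sum>l=0..m. ?s ! l) - int i" if "m \<in> {1..length ns - 1}" for m
    proof -
      have "Suc m \<le> length ?s" using that len by auto
      then have "(\<Sum>l<Suc m. int v - int (?s ! l)) \<le> int (excess ns v)"
        using prefix_le_excess[of "Suc m" ?s v] by (simp add: excess_sort)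
      then show ?thesis using L pref[of m] by (simp add: algebra_simps)
    qed
    with L q show "i \<le> v \<and> int v \<le> ?q" by auto
  next
    assume R: "i \<le> v \<and> int v \<le> ?q"
    obtain p where p: "p \<le> length ns" "int (excess ns v) = (\<Sum>l<p. int v - int (?s ! l))"
      using sorted_excess_prefix[of ?s v] by (auto simp: excess_sort)
    show ?L
    proof (cases p)
      case 0
      then show ?thesis using p R by simp
    next
      case (Suc m)
      have "int m * int v \<le> int (\<Sum>l=0..m. ?s ! l) - int i"
      proof (cases "m = 0")
        case True
        have "?s ! 0 \<in> set ns" using len by (metis Suc_le_lessD length_sort less_le_trans
              nth_mem numeral_2_eq_2 set_sort zero_less_Suc)
        then show ?thesis using True i nmin_le[of "?s ! 0" ns] by simp
      next
        case False
        then show ?thesis using R q p(1) Suc by auto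
      qed
      then show ?thesis using p(2) pref[of m] Suc by (simp add: algebra_simps)
    qed
  qed
qed

lemma rp_coeff_eq_card:
  assumes len: "2 \<le> length ns" and i: "1 \<le> i" "i \<le> nmin ns" and V: "sum_list ns \<le> V"
  shows "rp_coeff ns i = int (card {v\<in>{..V}. i + excess ns v \<le> v})"
proof -
  define q where
    "q = (MIN m\<in>{1..length ns - 1}. (int (\<Sum>l=0..m. sort ns ! l) - int i) div int m)"
  note iff = le_rp_min_iff[OF len i(2), folded q_def]
  \<comment> \<open>Below \<open>nmin ns\<close> there is no excess, so f(i) = i. Hence the interval
    from \<open>i\<close> to \<open>q\<close> is nonempty, and its size q - i + 1 is the
    coefficient.\<close>
  have "int i \<le> q"
    using iff[of i] excess_eq_0[OF i(2)] by simp
  have "{v\<in>{..V}. i + excess ns v \<le> v} = {v. i + excess ns v \<le> v}"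
  proof -
    have "v \<le> V" if "i + excess ns v \<le> v" for v
      using minus_excess_pos_le[OF len, of v] i(1) V that by linarith
    then show ?thesis by auto
  qed
  also have "\<dots> = {i..nat q}"
    unfolding iff using \<open>int i \<le> q\<close> by auto
  finally show ?thesis
    using \<open>int i \<le> q\<close> unfolding rp_coeff_def q_def[symmetric] by simp
qed

text \<open>Double counting of the pairs (i, v) with k < i \<le> f(v). The bound \<open>V\<close> is
  left free so that sums for different lists can share one range.\<close>

lemma dRP_eq_sum:
  assumes len: "2 \<le> length ns" and V: "sum_list ns \<le> V"
  shows "dRP ns k = (\<Sum>v\<le>V. int (v - (k + excess ns v)))"
proof -
  have ne: "ns \<noteq> []" using len by auto
  have "dRP ns k = (\<Sum>i=k+1..nmin ns. int (card {v\<in>{..V}. i + excess ns v \<le> v}))"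
    unfolding dRP_def using rp_coeff_eq_card[OF len _ _ V] by (intro sum.cong) auto
  also have "\<dots> = (\<Sum>i=k+1..nmin ns. \<Sum>v\<le>V. of_bool (i + excess ns v \<le> v))"
    by (intro sum.cong refl) (simp add: of_bool_def sum.If_cases Int_def)
  also have "\<dots> = (\<Sum>v\<le>V. \<Sum>i=k+1..nmin ns. of_bool (i + excess ns v \<le> v))"
    by (rule sum.swap)
  also have "\<dots> = (\<Sum>v\<le>V. int (v - (k + excess ns v)))"
  proof (intro sum.cong refl)
    fix v
    have "{i\<in>{k+1..nmin ns}. i + excess ns v \<le> v} = {k+1..v - excess ns v}"
      using minus_excess_le_nmin[OF ne, of v] by auto
    then show "(\<Sum>i=k+1..nmin ns. of_bool (i + excess ns v \<le> v)) = int (v - (k + excess ns v))"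
      by (simp add: of_bool_def sum.If_cases Int_def)
  qed
  finally show ?thesis .
qed

section \<open>The relations\<close>

lemma rel_R1_dRP: "rel_R1 dRP"
  unfolding rel_R1_def
proof (intro allI impI)
  fix ns :: "nat list" and k
  assume len: "2 \<le> length ns" and k: "k \<le> nmin ns"
  let ?ms = "map (\<lambda>n. n - k) ns" and ?V = "sum_list ns"
  have shift: "excess ?ms v = excess ns (v + k)" for v
  proof -
    have "v - (n - k) = v + k - n" if "n \<in> set ns" for n
      using nmin_le[OF that] k by simp
    then show ?thesis by (simp add: excess_def o_def cong: map_cong)
  qed
  have "sum_list ?ms \<le> sum_list (map (\<lambda>n. n) ns)"
    by (intro sum_list_mono) simp
  then have V: "sum_list ?ms \<le> ?V" by simp
  have "dRP ns k = (\<Sum>v\<le>?V + k. int (v - (k + excess ns v)))"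
    using dRP_eq_sum[OF len] by simp
  \<comment> \<open>The terms with v < k vanish by truncation.\<close>
  also have "\<dots> = (\<Sum>v=k..?V + k. int (v - (k + excess ns v)))"
    by (intro sum.mono_neutral_right) auto
  also have "\<dots> = (\<Sum>v=0..?V. int (v - excess ns (v + k)))"
    using sum.shift_bounds_cl_nat_ivl[of "\<lambda>v. int (v - (k + excess ns v))" 0 k ?V]
    by simp
  also have "\<dots> = dRP ?ms 0"
    using dRP_eq_sum[of ?ms ?V 0] len V by (simp add: shift atLeast0AtMost)
  finally show "dRP ns k = dRP ?ms 0" .
qed

section \<open>Splitting the list of dimensions at j\<close>

lemma dRP_append_le:
  assumes A: "2 \<le> length A" and B: "B \<noteq> []" and j: "j \<le> nmin A"
  shows "dRP (A @ B) k \<le> dRP A j + dRP (j # B) k"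
proof -
  \<comment> \<open>A common bound for the entry sums of \<open>A\<close>, \<open>j # B\<close> and
    \<open>A @ B\<close>.\<close>
  let ?V = "j + sum_list (A @ B)"
  have "2 \<le> length (j # B)" "2 \<le> length (A @ B)" using A B by (auto simp: Suc_le_eq)
  note eqs = dRP_eq_sum[OF A, of ?V j] dRP_eq_sum[OF this(1), of ?V k]
    dRP_eq_sum[OF this(2), of ?V k]
  have "(\<Sum>v\<le>?V. int (v - (k + excess (A @ B) v)))
      \<le> (\<Sum>v\<le>?V. int (v - (j + excess A v)) + int (v - (k + excess (j # B) v)))"
    \<comment> \<open>For v \<ge> j the last summand is the positive part of y; for v < j it
      dominates the left side alone.\<close>
    by (intro sum_mono) (auto simp: excess_append)
  then show ?thesis using eqs by (simp add: sum.distrib)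
qed

lemma dRP_append_eq:
  assumes A: "2 \<le> length A" and B: "B \<noteq> []" and k: "k \<le> nmin (A @ B)"
  shows "\<exists>j\<in>{k..nmin A}. dRP (A @ B) k = dRP A j + dRP (j # B) k"
proof -
  have ne: "A \<noteq> []" using A by auto
  have kA: "k \<le> nmin A"
    using k nmin_le[of "nmin A" "A @ B"] nmin_in[OF ne] by simp
  \<comment> \<open>The implication says that x > 0 forces y \<ge> 0. It is vacuous at
    \<open>nmin A\<close>, which f for \<open>A\<close> never exceeds.\<close>
  define P where "P j \<longleftrightarrow> k \<le> j \<and> (\<forall>v. j < v - excess A v \<longrightarrow> k + excess B v \<le> j)" for j
  define j where "j = (LEAST j. P j)"
  have "P (nmin A)"
    using kA minus_excess_le_nmin[OF ne] by (auto simp: P_def not_less[symmetric])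
  then have Pj: "P j" and ja: "j \<le> nmin A"
    unfolding j_def by (auto intro: LeastI Least_le)
  have nbad: "j \<le> k + excess B v" if v: "j \<le> v" "v - excess A v < j" for v
  proof (rule ccontr)
    assume neg: "\<not> j \<le> k + excess B v"
    \<comment> \<open>Here y > 0 gives j > k, so \<open>j - 1\<close> still meets the lower bound
      \<open>k\<close>; its failure must come from some \<open>w\<close> with x > 0 > y at
      \<open>j - 1\<close>.\<close>
    then have "\<not> P (j - 1)"
      using not_less_Least[of "j - 1" P] j_def by simp
    then obtain w where "j - 1 < w - excess A w" "\<not> k + excess B w \<le> j - 1"
      using neg unfolding P_def by auto
    then have w: "j \<le> w - excess A w" "j \<le> k + excess B w"
      by linarith+
    \<comment> \<open>\<open>excess B v < j - k \<le> excess B w\<close>, so \<open>w\<close> cannot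
      lie below \<open>v\<close>. Past \<open>nmin A\<close> the value of f for \<open>A\<close>
      would then have to rise from below \<open>j\<close> to at least \<open>j\<close>.\<close>
    have vw: "v \<le> w"
      using neg w(2) excess_mono[of w v B] by linarith
    show False
    proof (cases "v \<le> nmin A")
      case True
      then show False using v excess_eq_0[of v A] by simp
    next
      case False
      then show False using minus_excess_antimono[OF ne _ vw] w(1) v by simp
    qed
  qed
  let ?V = "j + sum_list (A @ B)"
  have "2 \<le> length (j # B)" "2 \<le> length (A @ B)" using A B by (auto simp: Suc_le_eq)
  note eqs = dRP_eq_sum[OF A, of ?V j] dRP_eq_sum[OF this(1), of ?V k]
    dRP_eq_sum[OF this(2), of ?V k]
  \<comment> \<open>For v \<le> j \<le> \<open>nmin A\<close> the excess of \<open>A\<close> and the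
    first summand vanish. Otherwise x and y never have strictly opposite signs, so their positive
    parts add up.\<close>
  have "v - (k + excess (A @ B) v) = (v - (j + excess A v)) + (v - (k + excess (j # B) v))" for v
  proof (cases "v \<le> j")
    case True
    then show ?thesis using excess_eq_0[of v A] ja by (simp add: excess_append)
  next
    case False
    then show ?thesis
      using nbad[of v] Pj[unfolded P_def, THEN conjunct2, rule_format, of v]
      by (simp add: excess_append) linarith
  qed
  then have "dRP (A @ B) k = dRP A j + dRP (j # B) k"
    using eqs by (simp add: sum.distrib)
  then show ?thesis using Pj ja by (auto simp: P_def)
qed

lemma rel_R3_dRP: "rel_R3 dRP"
  unfolding rel_R3_def
proof (intro allI impI)
  fix ns :: "nat list" and i k
  assume i: "1 \<le> i" "i + 1 \<le> length ns - 1" and k: "k \<le> nmin ns"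
  let ?A = "take (Suc i) ns" and ?B = "drop (Suc i) ns"
  have A: "2 \<le> length ?A" and B: "?B \<noteq> []" using i by auto
  show "dRP ns k = (MIN j\<in>{k..nmin ?A}. dRP ?A j + dRP (j # ?B) k)"
    using dRP_append_le[OF A B, of _ k] dRP_append_eq[OF A B, of k] k
    by (intro Min_eqI[symmetric]) auto
qed

section \<open>The case k = 0, and uniqueness\<close>

lemma rel_R3_imp_R2: "rel_R3 d \<Longrightarrow> rel_R2 d"
  by (simp add: rel_R2_def rel_R3_def)

text \<open>At i = 1 the relation replaces the first two dimensions by the single \<open>j\<close>,
  so the length drops by one until only pairs remain, whose values are prescribed by
  \<open>base\<close>.\<close>

lemma rel_R3_unique:
  assumes d: "rel_R3 d" and e: "rel_R3 e"
    and base: "\<And>a b k. k \<le> min a b \<Longrightarrow> d [a, b] k = e [a, b] k"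
    and "2 \<le> length ns" "k \<le> nmin ns"
  shows "d ns k = e ns k"
  using assms(4,5)
proof (induction "length ns" arbitrary: ns k rule: less_induct)
  case less
  obtain a b ms where ns: "ns = a # b # ms"
    using less.prems(1) by (metis Suc_le_length_iff numeral_2_eq_2)
  show ?case
  proof (cases "ms = []")
    case True
    then show ?thesis using base less.prems(2) ns by (simp add: nmin_def)
  next
    case False
    have rec: "f ns k = (MIN j\<in>{k..nmin [a, b]}. f [a, b] j + f (j # ms) k)" if "rel_R3 f" for f
      using that[unfolded rel_R3_def, rule_format, of ns 1 k] less.prems ns False
      by (simp add: Suc_le_eq)
    have "d [a, b] j + d (j # ms) k = e [a, b] j + e (j # ms) k"
      if j: "j \<in> {k..nmin [a, b]}" for j
    proof -
      \<comment> \<open>The restriction j \<ge> k in the minimum keeps \<open>k\<close> admissible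
        for the shorter list.\<close>
      have "k \<le> nmin (j # ms)"
        using j less.prems(2) ns False by (simp add: nmin_def)
      then have "d (j # ms) k = e (j # ms) k"
        using less.hyps[of "j # ms" k] ns False by (simp add: Suc_le_eq)
      then show ?thesis using base j by (simp add: nmin_def)
    qed
    then have "(\<lambda>j. d [a, b] j + d (j # ms) k) ` {k..nmin [a, b]} =
        (\<lambda>j. e [a, b] j + e (j # ms) k) ` {k..nmin [a, b]}"
      by (intro image_cong refl)
    then show ?thesis by (simp only: rec[OF d] rec[OF e])
  qed
qed

theorem mainTheorem6:
  shows "rel_R1 dRP \<and> rel_R2 dRP \<and> rel_R3 dRP \<and>
    (\<forall>d :: nat list \<Rightarrow> nat \<Rightarrow> int.
       rel_R1 d \<longrightarrow> rel_R2 d \<longrightarrow> rel_R3 d \<longrightarrow>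
       (\<forall>a b k. k \<le> min a b \<longrightarrow> d [a, b] k = dRP [a, b] k) \<longrightarrow>
       (\<forall>ns k. 2 \<le> length ns \<longrightarrow> k \<le> nmin ns \<longrightarrow> d ns k = dRP ns k))"
  using rel_R1_dRP rel_R3_imp_R2[OF rel_R3_dRP] rel_R3_dRP rel_R3_unique[OF _ rel_R3_dRP]
  by blast

end
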